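(* In the long-run persuasion model described in the context, let $\alpha\ge1$ be the switching threshold. Suppose that there exists an action $a\in A$ such that (i) $a$ is non-revealing, i.e. $u(\omega^1,a)=u(\omega^2,a)$, and (ii) $v(\omega,a)>v(\omega,\hat a)$ for all $\omega\in\Omega$ and the action $\hat a\neq a$. Then for every $\delta\in(0,1)$ the BP-optimal information structure is optimal in the long run, i.e. it maximizes $\tilde V_{\alpha,\delta}(\mu_0\mid S,P)$ over all information structures $(S,P)$.
   Context: Model. States $\Omega=\{\omega^1,\omega^2\}$, actions $A=\{a^1,a^2\}$, prior $\mu_0$ on $\Omega$; a belief is identified with the probability $\mu$ of $\omega^1$, so $\mu_0$ also denotes $\mu_0(\omega^1)$. The Sender has period utility $v(\omega,a)$ and the Receivers have period utility $u(\omega,a)$. An information structure $(S,P)$ is a finite signal set $S$ with conditional probabilities $p(\omega,s)=\Pr(s\mid\omega)$. The Sender fixes $(S,P)$ once and for all; in each period $t=1,2,\dots$ the state $\omega_t\sim\mu_0$ is drawn i.i.d. and the signal $s_t$ is drawn from $p(\omega_t,\cdot)$, independently across periods. Actions. $a^*(\mu)\in\arg\max_{a\in A}[\mu u(\omega^1,a)+(1-\mu)u(\omega^2,a)]$, ties broken in favour of the Sender. An action $a$ is revealing if $u(\omega^1,a)\ne u(\omega^2,a)$, otherwise non-revealing; it is assumed that at least one action is revealing. Alternative structure. $(S,\hat P)$ is given by $\hat p(\omega,s)=\Pr(s)=\mu_0p(\omega^1,s)+(1-\mu_0)p(\omega^2,s)$ for both $\omega$ (uninformative, same signal distribution as $P$).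 Perceived structure and behaviour. In each period the Receiver has a perceived structure, either $P$ or $\hat P$ (in period 1 it is $P$). On seeing $s_t$ she forms the Bayes posterior under the perceived structure (under $\hat P$ it equals $\mu_0$) and plays $a^*$ of that posterior. The observation $o_t$ is $(s_t,\omega_t)$ if $a_t$ is revealing and $s_t$ if $a_t$ is non-revealing; the history is $h_t=(o_1,\dots,o_{t-1})$. For $Q\in\{P,\hat P\}$ with entries $q$, $l(o_t\mid Q)=\mu_0(\omega_t)q(\omega_t,s_t)$ if $a_t$ is revealing and $l(o_t\mid Q)=\mu_0q(\omega^1,s_t)+(1-\mu_0)q(\omega^2,s_t)$ if it is non-revealing; $l(h_t\mid Q)=\prod_{\tau=1}^{t-1}l(o_\tau\mid Q)$. The Bayes factor is $\lambda(h_t)=l(h_t\mid\hat P)/l(h_t\mid P)$. Switching rule with threshold $\alpha\ge1$. If the perceived structure in period $t-1$ was $P$, it becomes $\hat P$ in period $t$ iff $\lambda(h_t)>\alpha$; if it was $\hat P$, it becomes $P$ in period $t$ iff $1/\lambda(h_t)>\alpha$; otherwise it is unchanged. $A_t^\alpha(P)$ is the set of histories $h_t$ at which the perceived structure in period $t$ is $P$, and $l(A_t^\alpha(P))$ is its probability under the true process generated by $P$. Sender's payoff. $\hat v(\mu)=\mu v(\omega^1,a^*(\mu))+(1-\mu)v(\omega^2,a^*(\mu))$; $V(\mu_0\mid S,P)=\sum_\mu\pi_P(\mu)\hat v(\mu)$, where $\pi_P$ is the distribution of posteriors induced by $P$ and $\mu_0$; $V(\mu_0\mid S,\hat P)=\hat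 v(\mu_0)$. For $\delta\in(0,1)$, $$\tilde V_{\alpha,\delta}(\mu_0\mid S,P)=\sum_{t=1}^\infty\delta^{t-1}\Big[l(A_t^\alpha(P))V(\mu_0\mid S,P)+\big(1-l(A_t^\alpha(P))\big)V(\mu_0\mid S,\hat P)\Big].$$ $(S,P)$ is BP-optimal if it maximizes $V(\mu_0\mid S,P)$ over all information structures. *)

theory Defs
  imports "HOL-Probability.Probability_Mass_Function" "HOL-Library.Infinite_Typeclass"
begin

datatype state = W1 | W2
datatype action = A1 | A2

text \<open>A belief is the probability of \<open>W1\<close>, and the prior belief of a prior \<open>\<mu> :: state pmf\<close> is
  \<open>pmf \<mu> W1\<close>. An information structure \<open>(S, P)\<close> has \<open>p(\<omega>, s) = pmf (P \<omega>) s\<close>.\<close>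

definition info_structure :: "'s set \<Rightarrow> (state \<Rightarrow> 's pmf) \<Rightarrow> bool" where
  "info_structure S P \<longleftrightarrow> finite S \<and> (\<forall>\<omega>. set_pmf (P \<omega>) \<subseteq> S)"

definition expected_utility :: "(state \<Rightarrow> action \<Rightarrow> real) \<Rightarrow> real \<Rightarrow> action \<Rightarrow> real" where
  "expected_utility w \<mu> b = \<mu> * w W1 b + (1 - \<mu>) * w W2 b"

text \<open>\<open>astar\<close> selects a best response of the Receiver which, among all best responses, is best for
  the Sender.\<close>

definition sender_preferred_response ::
  "(state \<Rightarrow> action \<Rightarrow> real) \<Rightarrow> (state \<Rightarrow> action \<Rightarrow> real) \<Rightarrow> (real \<Rightarrow> action) \<Rightarrow> bool" where
  "sender_preferred_response u v astar \<longleftrightarrow>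
     (\<forall>\<mu>\<in>{0..1}. is_arg_max (expected_utility v \<mu>)
        (is_arg_max (expected_utility u \<mu>) (\<lambda>_. True)) (astar \<mu>))"

definition revealing :: "(state \<Rightarrow> action \<Rightarrow> real) \<Rightarrow> action \<Rightarrow> bool" where
  "revealing u b \<longleftrightarrow> u W1 b \<noteq> u W2 b"

definition signal_law :: "state pmf \<Rightarrow> (state \<Rightarrow> 's pmf) \<Rightarrow> 's pmf" where
  "signal_law prior Q = bind_pmf prior Q"

definition alt_structure :: "state pmf \<Rightarrow> (state \<Rightarrow> 's pmf) \<Rightarrow> state \<Rightarrow> 's pmf" where
  "alt_structure prior P = (\<lambda>_. signal_law prior P)"

text \<open>For signals of probability zero, division by zero makes the posterior \<open>0\<close>; such signals
  occur with probability zero, so this value never matters.\<close>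

definition posterior :: "state pmf \<Rightarrow> (state \<Rightarrow> 's pmf) \<Rightarrow> 's \<Rightarrow> real" where
  "posterior prior Q s = pmf prior W1 * pmf (Q W1) s / pmf (signal_law prior Q) s"

definition posterior_law :: "state pmf \<Rightarrow> (state \<Rightarrow> 's pmf) \<Rightarrow> real pmf" where
  "posterior_law prior Q = map_pmf (posterior prior Q) (signal_law prior Q)"

definition vhat :: "(state \<Rightarrow> action \<Rightarrow> real) \<Rightarrow> (real \<Rightarrow> action) \<Rightarrow> real \<Rightarrow> real" where
  "vhat v astar \<mu> = expected_utility v \<mu> (astar \<mu>)"

definition static_payoff ::
  "state pmf \<Rightarrow> (state \<Rightarrow> action \<Rightarrow> real) \<Rightarrow> (real \<Rightarrow> action) \<Rightarrow> (state \<Rightarrow> 's pmf) \<Rightarrow> real" where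
  "static_payoff prior v astar Q = measure_pmf.expectation (posterior_law prior Q) (vhat v astar)"

text \<open>An observation is \<open>Both s \<omega>\<close> after a revealing action and \<open>Signal s\<close> after a non-revealing
  one. Since the observation itself records which case occurred, its likelihood does not refer to
  the action. Histories are lists with the most recent observation first.\<close>

datatype 's observation = Both 's state | Signal 's

fun obs_likelihood :: "state pmf \<Rightarrow> (state \<Rightarrow> 's pmf) \<Rightarrow> 's observation \<Rightarrow> real" where
  "obs_likelihood prior Q (Both s \<omega>) = pmf prior \<omega> * pmf (Q \<omega>) s"
| "obs_likelihood prior Q (Signal s) =
     pmf prior W1 * pmf (Q W1) s + pmf prior W2 * pmf (Q W2) s"

definition likelihood :: "state pmf \<Rightarrow> (state \<Rightarrow> 's pmf) \<Rightarrow> 's observation list \<Rightarrow> real" where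
  "likelihood prior Q h = prod_list (map (obs_likelihood prior Q) h)"

text \<open>Both likelihoods are positive on every history of positive probability under \<open>P\<close>, so division
  by zero can only occur on null histories.\<close>

definition bayes_factor :: "state pmf \<Rightarrow> (state \<Rightarrow> 's pmf) \<Rightarrow> 's observation list \<Rightarrow> real" where
  "bayes_factor prior P h = likelihood prior (alt_structure prior P) h / likelihood prior P h"

datatype perception = Original | Alternative

text \<open>\<open>perceived \<alpha> prior P h\<close> is the structure perceived in the period that starts at history
  \<open>h\<close>.\<close>

primrec perceived ::
  "real \<Rightarrow> state pmf \<Rightarrow> (state \<Rightarrow> 's pmf) \<Rightarrow> 's observation list \<Rightarrow> perception" where
  "perceived \<alpha> prior P [] = Original"
| "perceived \<alpha> prior P (ob # h) =
     (case perceived \<alpha> prior P h of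
        Original \<Rightarrow> if bayes_factor prior P (ob # h) > \<alpha> then Alternative else Original
      | Alternative \<Rightarrow> if 1 / bayes_factor prior P (ob # h) > \<alpha> then Original else Alternative)"

definition perceived_structure ::
  "real \<Rightarrow> state pmf \<Rightarrow> (state \<Rightarrow> 's pmf) \<Rightarrow> 's observation list \<Rightarrow> state \<Rightarrow> 's pmf" where
  "perceived_structure \<alpha> prior P h =
     (case perceived \<alpha> prior P h of Original \<Rightarrow> P | Alternative \<Rightarrow> alt_structure prior P)"

definition played_action ::
  "real \<Rightarrow> state pmf \<Rightarrow> (real \<Rightarrow> action) \<Rightarrow> (state \<Rightarrow> 's pmf) \<Rightarrow> 's observation list \<Rightarrow> 's \<Rightarrow> action" where
  "played_action \<alpha> prior astar P h s =
     astar (posterior prior (perceived_structure \<alpha> prior P h) s)"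

definition observe ::
  "real \<Rightarrow> state pmf \<Rightarrow> (state \<Rightarrow> action \<Rightarrow> real) \<Rightarrow> (real \<Rightarrow> action) \<Rightarrow> (state \<Rightarrow> 's pmf) \<Rightarrow>
   's observation list \<Rightarrow> state \<Rightarrow> 's \<Rightarrow> 's observation" where
  "observe \<alpha> prior u astar P h \<omega> s =
     (if revealing u (played_action \<alpha> prior astar P h s) then Both s \<omega> else Signal s)"

text \<open>\<open>history_law \<alpha> prior u astar P n\<close> is the law of the history after \<open>n\<close> periods, that is, of
  \<open>h\<^sub>t\<close> with \<open>t = n + 1\<close>. Signals are always generated by \<open>P\<close>, whatever the Receiver perceives.\<close>

primrec history_law ::
  "real \<Rightarrow> state pmf \<Rightarrow> (state \<Rightarrow> action \<Rightarrow> real) \<Rightarrow> (real \<Rightarrow> action) \<Rightarrow> (state \<Rightarrow> 's pmf) \<Rightarrow>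
   nat \<Rightarrow> 's observation list pmf" where
  "history_law \<alpha> prior u astar P 0 = return_pmf []"
| "history_law \<alpha> prior u astar P (Suc n) =
     bind_pmf (history_law \<alpha> prior u astar P n) (\<lambda>h.
     bind_pmf prior (\<lambda>\<omega>.
     map_pmf (\<lambda>s. observe \<alpha> prior u astar P h \<omega> s # h) (P \<omega>)))"

definition prob_original ::
  "real \<Rightarrow> state pmf \<Rightarrow> (state \<Rightarrow> action \<Rightarrow> real) \<Rightarrow> (real \<Rightarrow> action) \<Rightarrow> (state \<Rightarrow> 's pmf) \<Rightarrow>
   nat \<Rightarrow> real" where
  "prob_original \<alpha> prior u astar P n =
     measure_pmf.prob (history_law \<alpha> prior u astar P n) {h. perceived \<alpha> prior P h = Original}"

text \<open>The summation index is \<open>n = t - 1\<close>.\<close>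

definition long_run_payoff ::
  "real \<Rightarrow> real \<Rightarrow> state pmf \<Rightarrow> (state \<Rightarrow> action \<Rightarrow> real) \<Rightarrow> (state \<Rightarrow> action \<Rightarrow> real) \<Rightarrow>
   (real \<Rightarrow> action) \<Rightarrow> (state \<Rightarrow> 's pmf) \<Rightarrow> real" where
  "long_run_payoff \<alpha> \<delta> prior u v astar P =
     (\<Sum>n. \<delta> ^ n *
        (prob_original \<alpha> prior u astar P n * static_payoff prior v astar P +
         (1 - prob_original \<alpha> prior u astar P n) *
           static_payoff prior v astar (alt_structure prior P)))"

text \<open>Both notions of optimality range over all finite sets of signals drawn from the type \<open>'s\<close>.
  When \<open>'s\<close> is infinite, these are all information structures up to relabelling of signals.\<close>

definition BP_optimal ::
  "state pmf \<Rightarrow> (state \<Rightarrow> action \<Rightarrow> real) \<Rightarrow> (real \<Rightarrow> action) \<Rightarrow> 's set \<Rightarrow> (state \<Rightarrow> 's pmf) \<Rightarrow> bool" where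
  "BP_optimal prior v astar S P \<longleftrightarrow> info_structure S P \<and>
     (\<forall>(S' :: 's set) (P' :: state \<Rightarrow> 's pmf). info_structure S' P' \<longrightarrow>
        static_payoff prior v astar P' \<le> static_payoff prior v astar P)"

definition long_run_optimal ::
  "real \<Rightarrow> real \<Rightarrow> state pmf \<Rightarrow> (state \<Rightarrow> action \<Rightarrow> real) \<Rightarrow> (state \<Rightarrow> action \<Rightarrow> real) \<Rightarrow>
   (real \<Rightarrow> action) \<Rightarrow> 's set \<Rightarrow> (state \<Rightarrow> 's pmf) \<Rightarrow> bool" where
  "long_run_optimal \<alpha> \<delta> prior u v astar S P \<longleftrightarrow> info_structure S P \<and>
     (\<forall>(S' :: 's set) (P' :: state \<Rightarrow> 's pmf). info_structure S' P' \<longrightarrow>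
        long_run_payoff \<alpha> \<delta> prior u v astar P' \<le> long_run_payoff \<alpha> \<delta> prior u v astar P)"

end

(* Idea. Let b be the other action. If a is never a best response, every structure yields the same
   static payoff. Otherwise, if some signal s of a BP-optimal structure induces b, then at most one
   state, the one in which b is the Receiver's strictly better action, has positive probability
   given s: else revealing the other state by a fresh signal would induce a more often. Hence a
   signal s followed by the revealing action multiplies the Bayes factor by
   Pr(s) / p(\<omega>, s) = prior(\<omega>) \<le> 1, while a non-revealing action leaves it unchanged.
   The Bayes factor therefore stays below 1 \<le> \<alpha>, the Receivers never switch, and the
   long-run payoff is the BP value in every period, which is an upper bound for any structure. *)
theory Submission
  imports Defs
begin

section \<open>Two-state priors and signal laws\<close>

lemma set_pmf_state: "set_pmf (prior :: state pmf) \<subseteq> {W1, W2}"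
  using state.exhaust by blast

lemma pmf_state_sum: "pmf prior W1 + pmf prior W2 = 1"
  using sum_pmf_eq_1[OF _ set_pmf_state[of prior]] by simp

lemma pmf_signal_law:
  "pmf (signal_law prior Q) s = pmf prior W1 * pmf (Q W1) s + pmf prior W2 * pmf (Q W2) s"
  unfolding signal_law_def pmf_bind
  by (subst integral_measure_pmf_real[of "{W1, W2}"])
     (use set_pmf_state[of prior] in \<open>auto simp: mult.commute\<close>)

lemma set_signal_law: "info_structure S Q \<Longrightarrow> set_pmf (signal_law prior Q) \<subseteq> S"
  unfolding info_structure_def signal_law_def by auto

lemma info_structure_alt: "info_structure S Q \<Longrightarrow> info_structure S (alt_structure prior Q)"
  using set_signal_law[of S Q prior] unfolding info_structure_def alt_structure_def by auto

section \<open>Unnormalised posteriors\<close>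

text \<open>Posterior weights before division by the signal's probability. They are additive over
  signals, and null signals need no convention for division by zero.\<close>

definition joint :: "state pmf \<Rightarrow> (state \<Rightarrow> 's pmf) \<Rightarrow> 's \<Rightarrow> state \<Rightarrow> real" where
  "joint prior Q s \<omega> = pmf prior \<omega> * pmf (Q \<omega>) s"

lemma joint_nonneg: "joint prior Q s \<omega> \<ge> 0"
  unfolding joint_def by simp

lemma sum_joint:
  assumes "info_structure S Q"
  shows "(\<Sum>s\<in>S. joint prior Q s \<omega>) = pmf prior \<omega>"
  using assms sum_pmf_eq_1[of S "Q \<omega>"]
  unfolding info_structure_def joint_def by (simp add: sum_distrib_left[symmetric])

definition weighted_utility :: "(state \<Rightarrow> action \<Rightarrow> real) \<Rightarrow> (state \<Rightarrow> real) \<Rightarrow> action \<Rightarrow> real" where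
  "weighted_utility U w c = w W1 * U W1 c + w W2 * U W2 c"

lemma sum_weighted_utility_joint:
  assumes "info_structure S Q"
  shows "(\<Sum>s\<in>S. weighted_utility U (joint prior Q s) c) = weighted_utility U (pmf prior) c"
  using sum_joint[OF assms, of prior]
  by (simp add: weighted_utility_def sum.distrib sum_distrib_right[symmetric])

text \<open>Lets later arguments name the states by their role instead of treating \<open>W1\<close>
  and \<open>W2\<close> separately.\<close>

lemma weighted_utility_two_states:
  assumes "x \<noteq> y"
  shows "weighted_utility U w c = w x * U x c + w y * U y c"
  using assms by (cases x; cases y) (auto simp: weighted_utility_def)

text \<open>Invariant under positive rescaling of \<open>w\<close>, hence applicable to unnormalised
  weights. Ties go to \<open>a\<close>, which will be the Sender's preferred action.\<close>

definition response :: "(state \<Rightarrow> action \<Rightarrow> real) \<Rightarrow> action \<Rightarrow> action \<Rightarrow> (state \<Rightarrow> real) \<Rightarrow> action" where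
  "response u a b w = (if weighted_utility u w b \<le> weighted_utility u w a then a else b)"

definition signal_value ::
  "(state \<Rightarrow> action \<Rightarrow> real) \<Rightarrow> (state \<Rightarrow> action \<Rightarrow> real) \<Rightarrow> action \<Rightarrow> action \<Rightarrow> (state \<Rightarrow> real) \<Rightarrow> real" where
  "signal_value u v a b w = weighted_utility v w (response u a b w)"

section \<open>Static payoffs under a Sender-dominant action\<close>

locale dominant_action =
  fixes u v :: "state \<Rightarrow> action \<Rightarrow> real"
    and astar :: "real \<Rightarrow> action"
    and a b :: action
  assumes response: "sender_preferred_response u v astar"
    and distinct: "a \<noteq> b"
    and dominant: "v \<omega> b < v \<omega> a"
begin

lemma action_cases: "c = a \<or> c = b"
  using distinct by (cases a; cases b; cases c) auto

text \<open>Dominance in each state makes \<open>a\<close> strictly better for the Sender at every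
  belief, so tie-breaking in the Sender's favour is tie-breaking towards \<open>a\<close>.\<close>

lemma astar_eq:
  assumes "0 \<le> \<mu>" "\<mu> \<le> 1"
  shows "astar \<mu> =
    (if expected_utility u \<mu> b \<le> expected_utility u \<mu> a then a else b)"
proof -
  have less: "expected_utility v \<mu> b < expected_utility v \<mu> a"
  \<comment> \<open>For positive \<mu> the \<open>W1\<close> term supplies strictness; at 0 only the
    \<open>W2\<close> term remains.\<close>
  proof (cases "\<mu> = 0")
    case False
    then show ?thesis
      using assms dominant[of W1] dominant[of W2] unfolding expected_utility_def
      by (intro add_less_le_mono mult_strict_left_mono mult_left_mono) auto
  qed (simp add: expected_utility_def dominant)
  have am: "is_arg_max (expected_utility v \<mu>)
      (is_arg_max (expected_utility u \<mu>) (\<lambda>_. True)) (astar \<mu>)"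
    using response assms unfolding sender_preferred_response_def by auto
  have le: "expected_utility u \<mu> c \<le> expected_utility u \<mu> (astar \<mu>)" for c
    using am unfolding is_arg_max_def by (auto simp: not_less)
  show ?thesis
  proof (cases "expected_utility u \<mu> b \<le> expected_utility u \<mu> a")
    case True
    then have "is_arg_max (expected_utility u \<mu>) (\<lambda>_. True) a"
      unfolding is_arg_max_def using action_cases by (metis leD order.refl)
    then have "astar \<mu> \<noteq> b"
      using am less unfolding is_arg_max_def by auto
    then show ?thesis
      using True action_cases[of "astar \<mu>"] by auto
  next
    case False
    then show ?thesis
      using le[of b] action_cases[of "astar \<mu>"] by auto
  qed
qed

lemma expected_utility_posterior:
  assumes "pmf (signal_law prior Q) s > 0"
  shows "pmf (signal_law prior Q) s * expected_utility U (posterior prior Q s) c =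
    weighted_utility U (joint prior Q s) c"
proof -
  define L where "L = pmf (signal_law prior Q) s"
  have L: "L = joint prior Q s W1 + joint prior Q s W2" "L > 0"
    using assms by (auto simp: L_def pmf_signal_law joint_def)
  have p: "L * posterior prior Q s = joint prior Q s W1"
    using L by (simp add: posterior_def joint_def L_def)
  then have "L * (1 - posterior prior Q s) = joint prior Q s W2"
    using L by (simp add: algebra_simps)
  with p show ?thesis
    unfolding L_def[symmetric] expected_utility_def weighted_utility_def
    by (simp add: distrib_left flip: mult.assoc)
qed

lemma posterior_bounds:
  assumes "pmf (signal_law prior Q) s > 0"
  shows "0 \<le> posterior prior Q s" "posterior prior Q s \<le> 1"
  using assms unfolding posterior_def by (auto simp: pmf_signal_law divide_le_eq)

lemma astar_posterior:
  assumes "pmf (signal_law prior Q) s > 0"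
  shows "astar (posterior prior Q s) = response u a b (joint prior Q s)"
proof -
  have "(expected_utility u (posterior prior Q s) b \<le> expected_utility u (posterior prior Q s) a) =
    (weighted_utility u (joint prior Q s) b \<le> weighted_utility u (joint prior Q s) a)"
    using assms by (simp flip: expected_utility_posterior[OF assms])
  then show ?thesis
    by (simp add: astar_eq[OF posterior_bounds[OF assms]] response_def)
qed

text \<open>The signal's probability cancels the denominator of the posterior. A null signal has
  both joint weights zero, so it contributes 0 on either side, whatever its posterior.\<close>

lemma static_payoff_eq_sum:
  assumes "info_structure S Q"
  shows "static_payoff prior v astar Q = (\<Sum>s\<in>S. signal_value u v a b (joint prior Q s))"
proof -
  have "static_payoff prior v astar Q =
    (\<Sum>s\<in>S. vhat v astar (posterior prior Q s) * pmf (signal_law prior Q) s)"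
    unfolding static_payoff_def posterior_law_def integral_map_pmf
    using assms set_signal_law[OF assms, of prior]
    by (intro integral_measure_pmf_real) (auto simp: info_structure_def)
  also have "\<dots> = (\<Sum>s\<in>S. signal_value u v a b (joint prior Q s))"
  proof (rule sum.cong[OF refl])
    fix s
    show "vhat v astar (posterior prior Q s) * pmf (signal_law prior Q) s =
      signal_value u v a b (joint prior Q s)"
    proof (cases "pmf (signal_law prior Q) s = 0")
      case True
      then have "joint prior Q s W1 = 0 \<and> joint prior Q s W2 = 0"
        using joint_nonneg[of prior Q s] by (simp add: pmf_signal_law joint_def add_nonneg_eq_0_iff)
      with True show ?thesis
        by (simp add: signal_value_def weighted_utility_def)
    next
      case False
      then have "pmf (signal_law prior Q) s > 0"
        by (simp add: pmf_nonneg order_less_le)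
      then show ?thesis
        by (simp add: vhat_def signal_value_def astar_posterior mult.commute
            flip: expected_utility_posterior)
    qed
  qed
  finally show ?thesis .
qed

text \<open>Every nonzero weight vector induces \<open>b\<close>. At zero weights
  \<open>response\<close> breaks the tie towards \<open>a\<close>, but then both values are 0. The
  joint weights add up to the prior, so the structure drops out.\<close>

lemma static_payoff_never_a:
  assumes "info_structure S Q" and "\<And>\<omega>. u \<omega> a < u \<omega> b"
  shows "static_payoff prior v astar Q = weighted_utility v (pmf prior) b"
proof -
  have "signal_value u v a b (joint prior Q s) = weighted_utility v (joint prior Q s) b" for s
  proof (cases "joint prior Q s W1 = 0 \<and> joint prior Q s W2 = 0")
    case False
    let ?w = "joint prior Q s"
    have le: "?w \<omega> * u \<omega> a \<le> ?w \<omega> * u \<omega> b" for \<omega>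
      using assms(2)[of \<omega>] joint_nonneg[of prior Q s \<omega>] by (simp add: mult_left_mono)
    have "?w \<omega> * u \<omega> a < ?w \<omega> * u \<omega> b" if "?w \<omega> \<noteq> 0" for \<omega>
      using assms(2)[of \<omega>] joint_nonneg[of prior Q s \<omega>] that by simp
    then have "weighted_utility u ?w a < weighted_utility u ?w b"
      using False le[of W1] le[of W2] unfolding weighted_utility_def
      by (meson add_le_less_mono add_less_le_mono)
    then show ?thesis
      by (simp add: signal_value_def response_def)
  qed (simp add: signal_value_def weighted_utility_def)
  then show ?thesis
    by (simp add: static_payoff_eq_sum[OF assms(1)] sum_weighted_utility_joint[OF assms(1)])
qed

section \<open>Signals of BP-optimal structures\<close>

text \<open>Renaming \<open>s\<close> to a fresh signal in state \<open>x\<close> alone reveals \<open>x\<close>, which induces \<open>a\<close>.\<close>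

lemma BP_optimal_favourable_state_null:
  fixes P :: "state \<Rightarrow> 's::infinite pmf"
  assumes opt: "BP_optimal prior v astar S P"
    and s: "s \<in> S"
    and b: "response u a b (joint prior P s) = b"
    and x: "u x b \<le> u x a"
  shows "joint prior P s x = 0"
proof (rule ccontr)
  assume "joint prior P s x \<noteq> 0"
  then have pos: "joint prior P s x > 0"
    using joint_nonneg[of prior P s x] by simp
  obtain y where y: "x \<noteq> y"
    by (metis state.distinct(1))
  have P: "info_structure S P"
    using opt unfolding BP_optimal_def by blast
  then have fin: "finite S" and sub: "set_pmf (P \<omega>) \<subseteq> S" for \<omega>
    unfolding info_structure_def by auto
  \<comment> \<open>The fresh signal exists because \<open>S\<close> is finite and the signal type
    is infinite.\<close>
  obtain t where t: "t \<notin> S"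
    using fin ex_new_if_finite[of S] infinite_UNIV by blast
  have ts: "t \<noteq> s"
    using s t by blast
  define f where "f r = (if r = s then t else r)" for r
  define P' where "P' = P(x := map_pmf f (P x))"
  have P': "info_structure (insert t S) P'"
    using fin sub unfolding info_structure_def P'_def f_def by auto
  have zero: "pmf (P \<omega>) t = 0" for \<omega>
    using sub[of \<omega>] t by (auto simp: set_pmf_iff)
  have pmf_f: "pmf (map_pmf f (P x)) r =
      (if r = s then 0 else if r = t then pmf (P x) s else pmf (P x) r)" for r
  proof -
    \<comment> \<open>As \<open>f\<close> fixes \<open>t\<close>, the preimage of \<open>t\<close>
      also contains \<open>t\<close> itself, which carries no mass under \<open>P\<close>.\<close>
    have "f -` {r} = (if r = s then {} else if r = t then {s, t} else {r})"
      using ts by (simp add: set_eq_iff f_def)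
    then show ?thesis
      using ts zero[of x]
      by (auto simp: pmf_map measure_pmf_single measure_measure_pmf_finite)
  qed
  have eq: "joint prior P' r = joint prior P r" if "r \<noteq> s" "r \<noteq> t" for r
    using that by (auto simp: fun_eq_iff joint_def P'_def pmf_f)
  have t_x: "joint prior P' t x = joint prior P s x" and t_y: "joint prior P' t y = 0"
    and s_x: "joint prior P' s x = 0" and s_y: "joint prior P' s y = joint prior P s y"
    and t_0: "joint prior P t \<omega> = 0" for \<omega>
    using y ts zero by (auto simp: joint_def P'_def pmf_f)
  let ?F = "signal_value u v a b"
  have sum_P: "static_payoff prior v astar P =
      (\<Sum>r\<in>S - {s}. ?F (joint prior P r)) + ?F (joint prior P s)"
    using static_payoff_eq_sum[OF P, of prior] fin s by (simp add: sum.remove[of S s])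
  have sum_P': "static_payoff prior v astar P' = (\<Sum>r\<in>S - {s}. ?F (joint prior P r)) +
      ?F (joint prior P' s) + ?F (joint prior P' t)"
  proof -
    have "(\<Sum>r\<in>S - {s}. ?F (joint prior P' r)) = (\<Sum>r\<in>S - {s}. ?F (joint prior P r))"
      using t by (intro sum.cong refl arg_cong[where f = ?F] eq) auto
    then show ?thesis
      using static_payoff_eq_sum[OF P', of prior] fin s t by (simp add: sum.remove[of S s])
  qed
  note two = weighted_utility_two_states[OF y]
  have Ft: "?F (joint prior P' t) = joint prior P s x * v x a"
    using x pos by (simp add: signal_value_def response_def two t_x t_y)
  \<comment> \<open>The response to \<open>s\<close> may change once state \<open>x\<close> is
    removed from it; whichever action results, the Sender gets at least the value of
    \<open>b\<close> in state \<open>y\<close>.\<close>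
  have "v y b \<le> v y c" for c
    using action_cases[of c] dominant[of y] by auto
  then have Fs: "?F (joint prior P' s) \<ge> joint prior P s y * v y b"
    using joint_nonneg[of prior P s y]
    by (simp add: signal_value_def two s_x s_y mult_left_mono)
  have F: "?F (joint prior P s) = joint prior P s x * v x b + joint prior P s y * v y b"
    by (simp add: signal_value_def b two)
  \<comment> \<open>The strict gain: the mass of state \<open>x\<close> at \<open>s\<close> moves
    from action \<open>b\<close> to action \<open>a\<close>.\<close>
  have "joint prior P s x * v x b < joint prior P s x * v x a"
    using pos dominant by simp
  then have "static_payoff prior v astar P < static_payoff prior v astar P'"
    using sum_P sum_P' Ft Fs F by linarith
  then show False
    using opt P' unfolding BP_optimal_def by force
qed

text \<open>Prepares the hypothesis \<open>ratio\<close> of \<open>never_switch\<close>: since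
  \<open>x\<close> is null given \<open>s\<close>, the signal can only come from \<omega>, whose
  prior weight is at most 1.\<close>

lemma BP_optimal_likelihood_ratio:
  fixes P :: "state \<Rightarrow> 's::infinite pmf"
  assumes opt: "BP_optimal prior v astar S P"
    and x: "u x b \<le> u x a"
    and \<omega>: "\<omega> \<in> set_pmf prior"
    and s: "s \<in> set_pmf (P \<omega>)"
    and b: "astar (posterior prior P s) = b"
  shows "pmf (signal_law prior P) s \<le> pmf (P \<omega>) s"
proof -
  have P: "info_structure S P"
    using opt unfolding BP_optimal_def by blast
  have "s \<in> S"
    using P s unfolding info_structure_def by blast
  have "s \<in> set_pmf (signal_law prior P)"
    using \<omega> s unfolding signal_law_def by auto
  then have "response u a b (joint prior P s) = b"
    using b astar_posterior[OF pmf_positive] by metis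
  then have x0: "joint prior P s x = 0"
    using BP_optimal_favourable_state_null[OF opt \<open>s \<in> S\<close> _ x] by blast
  have "joint prior P s \<omega> \<noteq> 0"
    using \<omega> s by (simp add: joint_def set_pmf_iff)
  with x0 have "x \<noteq> \<omega>"
    by blast
  then have "pmf (signal_law prior P) s = joint prior P s x + joint prior P s \<omega>"
    by (cases x; cases \<omega>) (auto simp: pmf_signal_law joint_def)
  also have "\<dots> \<le> pmf (P \<omega>) s"
    by (simp only: x0) (simp add: joint_def mult_left_le_one_le pmf_le_1)
  finally show ?thesis .
qed

end

section \<open>Bayes factors along histories\<close>

lemma obs_likelihood_nonneg: "obs_likelihood prior Q ob \<ge> 0"
  by (cases ob) auto

lemma likelihood_nonneg: "likelihood prior Q h \<ge> 0"
  unfolding likelihood_def by (induction h) (auto simp: obs_likelihood_nonneg)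

lemma bayes_factor_Cons:
  "bayes_factor prior P (ob # h) =
    obs_likelihood prior (alt_structure prior P) ob / obs_likelihood prior P ob *
    bayes_factor prior P h"
  by (simp add: bayes_factor_def likelihood_def)

text \<open>Without the state, an observation tests only the marginal law of signals, on which the
  two structures agree.\<close>

lemma obs_likelihood_alt_Signal:
  "obs_likelihood prior (alt_structure prior P) (Signal s) = obs_likelihood prior P (Signal s)"
  using pmf_state_sum[of prior]
  by (simp add: alt_structure_def flip: distrib_right) (simp add: pmf_signal_law)

text \<open>The two claims need a joint induction: the perception \<open>Original\<close> ensures
  that actions follow posteriors under \<open>P\<close>, so that \<open>ratio\<close> applies, and
  the bound on the Bayes factor preserves that perception.\<close>

lemma never_switch:
  assumes "\<alpha> \<ge> 1"
    and ratio: "\<And>\<omega> s. \<omega> \<in> set_pmf prior \<Longrightarrow> s \<in> set_pmf (P \<omega>) \<Longrightarrow>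
      revealing u (astar (posterior prior P s)) \<Longrightarrow> pmf (signal_law prior P) s \<le> pmf (P \<omega>) s"
    and "h \<in> set_pmf (history_law \<alpha> prior u astar P n)"
  shows "perceived \<alpha> prior P h = Original \<and> bayes_factor prior P h \<le> 1"
  using assms(3)
proof (induction n arbitrary: h)
  case 0
  then show ?case
    by (simp add: bayes_factor_def likelihood_def)
next
  case (Suc n)
  from Suc.prems obtain g \<omega> s where g: "g \<in> set_pmf (history_law \<alpha> prior u astar P n)"
    and \<omega>: "\<omega> \<in> set_pmf prior" and s: "s \<in> set_pmf (P \<omega>)"
    and h: "h = observe \<alpha> prior u astar P g \<omega> s # g"
    by auto
  note IH = Suc.IH[OF g]
  let ?ob = "observe \<alpha> prior u astar P g \<omega> s"
  have pos: "pmf prior \<omega> > 0" "pmf (P \<omega>) s > 0"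
    using \<omega> s by (auto simp: pmf_positive)
  have "obs_likelihood prior (alt_structure prior P) ?ob \<le> obs_likelihood prior P ?ob"
  proof (cases "revealing u (astar (posterior prior P s))")
    case True
    with IH have "?ob = Both s \<omega>"
      by (simp add: observe_def played_action_def perceived_structure_def)
    with ratio[OF \<omega> s True] show ?thesis
      by (simp add: alt_structure_def mult_left_mono)
  next
    case False
    with IH have "?ob = Signal s"
      by (simp add: observe_def played_action_def perceived_structure_def)
    then show ?thesis
      by (simp only: obs_likelihood_alt_Signal order.refl)
  qed
  \<comment> \<open>A zero denominator would be harmless here, as the quotient is then 0.\<close>
  then have "obs_likelihood prior (alt_structure prior P) ?ob / obs_likelihood prior P ?ob \<le> 1"
    using obs_likelihood_nonneg[of prior P ?ob] by (auto simp: divide_le_eq_1)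
  moreover have "bayes_factor prior P g \<ge> 0"
    by (simp add: bayes_factor_def likelihood_nonneg)
  ultimately have "bayes_factor prior P h \<le> 1"
    using IH obs_likelihood_nonneg unfolding h bayes_factor_Cons
    by (intro mult_le_one) auto
  \<comment> \<open>From \<open>Original\<close> only the test against \<alpha> is made, and it
    fails because the factor is at most 1.\<close>
  then show ?case
    using IH \<open>\<alpha> \<ge> 1\<close> by (simp add: h)
qed

section \<open>Discounted payoffs and long-run optimality\<close>

lemma long_run_payoff_le:
  assumes \<delta>: "0 < \<delta>" "\<delta> < 1"
    and P: "static_payoff prior v astar P \<le> M"
    and alt: "static_payoff prior v astar (alt_structure prior P) \<le> M"
  shows "long_run_payoff \<alpha> \<delta> prior u v astar P \<le> (\<Sum>n. \<delta> ^ n * M)"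
proof -
  define p where "p = prob_original \<alpha> prior u astar P"
  define x where "x = static_payoff prior v astar P"
  define y where "y = static_payoff prior v astar (alt_structure prior P)"
  have p: "0 \<le> p n" "p n \<le> 1" for n
    unfolding p_def prob_original_def by auto
  have geo: "summable (\<lambda>n. \<delta> ^ n * c)" for c
    using \<delta> by (intro summable_mult2 summable_geometric) simp
  \<comment> \<open>Comparing the series termwise requires its convergence; a geometric majorant
    independent of the switching probabilities provides it.\<close>
  have "norm (\<delta> ^ n * (p n * x + (1 - p n) * y)) \<le> \<delta> ^ n * (\<bar>x\<bar> + \<bar>y\<bar>)" for n
  proof -
    have "\<bar>p n * x\<bar> \<le> \<bar>x\<bar>" "\<bar>(1 - p n) * y\<bar> \<le> \<bar>y\<bar>"
      using p[of n] by (auto simp: abs_mult mult_left_le_one_le)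
    then have "\<bar>p n * x + (1 - p n) * y\<bar> \<le> \<bar>x\<bar> + \<bar>y\<bar>"
      by linarith
    then show ?thesis
      using \<delta> by (simp add: abs_mult)
  qed
  then have "summable (\<lambda>n. \<delta> ^ n * (p n * x + (1 - p n) * y))"
    by (intro summable_comparison_test[OF _ geo]) blast
  moreover have "\<delta> ^ n * (p n * x + (1 - p n) * y) \<le> \<delta> ^ n * M" for n
  proof -
    have "p n * x + (1 - p n) * y \<le> M"
      using p[of n] P alt unfolding x_def y_def by (intro convex_bound_le) auto
    then show ?thesis
      using \<delta> by simp
  qed
  ultimately show ?thesis
    unfolding long_run_payoff_def p_def x_def y_def by (intro suminf_le geo) auto
qed

theorem proposition2:
  fixes prior :: "state pmf"
    and u v :: "state \<Rightarrow> action \<Rightarrow> real"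
    and astar :: "real \<Rightarrow> action"
    and \<alpha> :: real
    and S :: "'s::infinite set"
    and P :: "state \<Rightarrow> 's pmf"
  assumes "sender_preferred_response u v astar"
    and "\<exists>b. revealing u b"
    and "\<alpha> \<ge> 1"
    and "\<exists>a. \<not> revealing u a \<and> (\<forall>\<omega> b. b \<noteq> a \<longrightarrow> v \<omega> a > v \<omega> b)"
    and "BP_optimal prior v astar S P"
  shows "\<forall>\<delta>. 0 < \<delta> \<and> \<delta> < 1 \<longrightarrow> long_run_optimal \<alpha> \<delta> prior u v astar S P"
proof -
  obtain a where a: "\<not> revealing u a" "\<And>\<omega> b. b \<noteq> a \<Longrightarrow> v \<omega> a > v \<omega> b"
    using assms(4) by blast
  obtain b where ab: "a \<noteq> b"
    by (metis action.distinct(1))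
  interpret dominant_action u v astar a b
    using assms(1) a ab by unfold_locales auto
  define M where "M = static_payoff prior v astar P"
  have P: "info_structure S P"
    and max: "info_structure S' P' \<Longrightarrow> static_payoff prior v astar P' \<le> M"
    for S' :: "'s set" and P'
    using assms(5) unfolding BP_optimal_def M_def by blast+
  \<comment> \<open>Each period yields the BP value: either no switch ever occurs, or switching does
    not affect the payoff.\<close>
  have period: "prob_original \<alpha> prior u astar P n * M + (1 - prob_original \<alpha> prior u astar P n) *
      static_payoff prior v astar (alt_structure prior P) = M" for n
  proof (cases "\<exists>x. u x b \<le> u x a")
    case True
    then obtain x where x: "u x b \<le> u x a"
      by blast
    have "pmf (signal_law prior P) s \<le> pmf (P \<omega>) s"
      if "\<omega> \<in> set_pmf prior" "s \<in> set_pmf (P \<omega>)" "revealing u (astar (posterior prior P s))" for \<omega> s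
      \<comment> \<open>A revealing action must be \<open>b\<close>, since \<open>a\<close> is
        non-revealing.\<close>
      using BP_optimal_likelihood_ratio[OF assms(5) x that(1,2)] that(3) a(1) action_cases by metis
    then have "perceived \<alpha> prior P h = Original"
      if "h \<in> set_pmf (history_law \<alpha> prior u astar P n)" for h
      using never_switch[OF assms(3) _ that] by blast
    then have "prob_original \<alpha> prior u astar P n = 1"
      unfolding prob_original_def by (subst measure_pmf.prob_eq_1) (auto simp: AE_measure_pmf_iff)
    then show ?thesis
      by simp
  next
    case False
    then have "u \<omega> a < u \<omega> b" for \<omega>
      by (simp add: not_le)
    then have "static_payoff prior v astar (alt_structure prior P) = M"
      using static_payoff_never_a[OF P] static_payoff_never_a[OF info_structure_alt[OF P]]
      by (simp add: M_def)
    then show ?thesis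
      by (simp add: algebra_simps)
  qed
  have payoff: "long_run_payoff \<alpha> \<delta> prior u v astar P = (\<Sum>n. \<delta> ^ n * M)" for \<delta>
    using period unfolding long_run_payoff_def M_def by simp
  show ?thesis
  proof (intro allI impI)
    fix \<delta> :: real
    assume \<delta>: "0 < \<delta> \<and> \<delta> < 1"
    \<comment> \<open>The alternative of a competitor is itself an information structure, so the BP
      value bounds the competitor's payoff under both perceptions.\<close>
    have "long_run_payoff \<alpha> \<delta> prior u v astar P' \<le> long_run_payoff \<alpha> \<delta> prior u v astar P"
      if P': "info_structure S' P'" for S' :: "'s set" and P'
      unfolding payoff
      using \<delta> max[OF P'] max[OF info_structure_alt[OF P']] by (intro long_run_payoff_le) auto
    with P show "long_run_optimal \<alpha> \<delta> prior u v astar S P"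
      unfolding long_run_optimal_def by blast
  qed
qed

end
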